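(* Let $\mathbf{\pi}=(\pi(k))_{k\ge1}$ be the invariant probability measure of a positive recurrent Lamperti chain on $\mathbb{N}=\{1,2,\dots\}$ with transition matrix $P$, and let $N\ge2$. Consider the following two probability measures on $\{1,\dots,N\}$: (i) $\pi_{(N)}(k)=\pi(k)/\sum_{l=1}^N\pi(l)$, $k=1,\dots,N$; (ii) $\pi_{(N)}(k)=\pi(k)$, $k=1,\dots,N-1$, and $\pi_{(N)}(N)=\sum_{k\ge N}\pi(k)$. In each case, let $F_{(N)}(j)\in[0,1]$ be determined by $\sum_{k=1}^{j}\pi_{(N)}(k)=\sum_{k=1}^N\pi_{(N)}(k)F_{(N)}(j)^k$, $j=1,\dots,N$, with $F_{(N)}(0)=0$, and let $P_{(N)}(i,j)=F_{(N)}(j)^i-F_{(N)}(j-1)^i$, $i,j\in\{1,\dots,N\}$, be the corresponding transition matrix. Then in both cases the truncation preserves the failure rate monotonicity of $P$: $P_{(N)}$ is failure rate monotone.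
   Context: A Lamperti chain on $\mathbb{N}$ with branching number $\nu$, $\mathbf{P}(\nu=j)>0$ for all $j\ge1$, is the Markov chain $X_{n+1}=\max_{j=1,\dots,X_n}\nu_{j,n+1}$ with $\nu_{j,n+1}$ i.i.d. copies of $\nu$; its transition matrix is $P(i,j)=F(j)^i-F(j-1)^i$ with $F(j)=\mathbf{P}(\nu\le j)$. A transition matrix $P$ is failure rate monotone if $P^c(i,j)=\sum_{k\le j}P(i,k)$ satisfies $P^c(i_1,j_1)P^c(i_2,j_2)\ge P^c(i_1,j_2)P^c(i_2,j_1)$ for all $i_1<i_2$ and $j_1<j_2$. *)

theory Defs
  imports "HOL-Probability.Probability"
begin

definition transition_matrix :: "nat set \<Rightarrow> (nat \<Rightarrow> nat \<Rightarrow> real) \<Rightarrow> bool" where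
  "transition_matrix S P \<longleftrightarrow>
     (\<forall>i\<in>S. (\<forall>j\<in>S. 0 \<le> P i j) \<and> (P i has_sum 1) S)"

definition row_cdf :: "nat set \<Rightarrow> (nat \<Rightarrow> nat \<Rightarrow> real) \<Rightarrow> nat \<Rightarrow> nat \<Rightarrow> real" where
  "row_cdf S P i j = (\<Sum>k\<in>{k\<in>S. k \<le> j}. P i k)"

definition failure_rate_monotone :: "nat set \<Rightarrow> (nat \<Rightarrow> nat \<Rightarrow> real) \<Rightarrow> bool" where
  "failure_rate_monotone S P \<longleftrightarrow>
     transition_matrix S P \<and>
     (\<forall>i1\<in>S. \<forall>i2\<in>S. \<forall>j1\<in>S. \<forall>j2\<in>S. i1 < i2 \<longrightarrow> j1 < j2 \<longrightarrow>
        row_cdf S P i1 j1 * row_cdf S P i2 j2 \<ge> row_cdf S P i1 j2 * row_cdf S P i2 j1)"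

definition invariant_probability ::
    "nat set \<Rightarrow> (nat \<Rightarrow> nat \<Rightarrow> real) \<Rightarrow> (nat \<Rightarrow> real) \<Rightarrow> bool" where
  "invariant_probability S P \<pi> \<longleftrightarrow>
     (\<forall>k\<in>S. 0 \<le> \<pi> k) \<and> (\<pi> has_sum 1) S \<and>
     (\<forall>j\<in>S. ((\<lambda>i. \<pi> i * P i j) has_sum \<pi> j) S)"

text \<open>
  The coordinate \<open>\<omega> (j, n)\<close> plays the role of \<open>\<nu>\<^bsub>j,n\<^esub>\<close>: under the product measure the
  coordinates are independent copies of \<open>\<nu>\<close>.
\<close>

definition lamperti_space :: "nat pmf \<Rightarrow> (nat \<times> nat \<Rightarrow> nat) measure" where
  "lamperti_space \<nu> = PiM UNIV (\<lambda>_. measure_pmf \<nu>)"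

primrec lamperti_chain :: "(nat \<times> nat \<Rightarrow> nat) \<Rightarrow> nat \<Rightarrow> nat \<Rightarrow> nat" where
  "lamperti_chain \<omega> i 0 = i"
| "lamperti_chain \<omega> i (Suc n) = Max ((\<lambda>j. \<omega> (j, Suc n)) ` {1..lamperti_chain \<omega> i n})"

definition lamperti_matrix :: "nat pmf \<Rightarrow> nat \<Rightarrow> nat \<Rightarrow> real" where
  "lamperti_matrix \<nu> i j =
     measure (lamperti_space \<nu>) {\<omega> \<in> space (lamperti_space \<nu>). lamperti_chain \<omega> i 1 = j}"

text \<open>The infimum is \<open>\<infinity>\<close> if the chain never returns to \<open>i\<close>.\<close>

definition return_time :: "(nat \<times> nat \<Rightarrow> nat) \<Rightarrow> nat \<Rightarrow> enat" where
  "return_time \<omega> i = (INF n\<in>{n. n \<ge> 1 \<and> lamperti_chain \<omega> i n = i}. enat n)"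

definition lamperti_positive_recurrent :: "nat pmf \<Rightarrow> bool" where
  "lamperti_positive_recurrent \<nu> \<longleftrightarrow>
     (\<forall>i\<ge>1. (\<integral>\<^sup>+ \<omega>. ennreal_of_enat (return_time \<omega> i) \<partial>lamperti_space \<nu>) < \<infinity>)"

definition power_matrix :: "(nat \<Rightarrow> real) \<Rightarrow> nat \<Rightarrow> nat \<Rightarrow> real" where
  "power_matrix F i j = F j ^ i - F (j - 1) ^ i"

definition normalized_truncation :: "(nat \<Rightarrow> real) \<Rightarrow> nat \<Rightarrow> nat \<Rightarrow> real" where
  "normalized_truncation \<pi> N k = \<pi> k / (\<Sum>l=1..N. \<pi> l)"

definition lumped_truncation :: "(nat \<Rightarrow> real) \<Rightarrow> nat \<Rightarrow> nat \<Rightarrow> real" where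
  "lumped_truncation \<pi> N k = (if k < N then \<pi> k else (\<Sum>\<^sub>\<infinity>l\<in>{N..}. \<pi> l))"

definition truncated_cdf_value :: "(nat \<Rightarrow> real) \<Rightarrow> nat \<Rightarrow> nat \<Rightarrow> real \<Rightarrow> bool" where
  "truncated_cdf_value p N j x \<longleftrightarrow>
     0 \<le> x \<and> x \<le> 1 \<and> (\<Sum>k=1..j. p k) = (\<Sum>k=1..N. p k * x ^ k)"

text \<open>Meaningful only where \<^const>\<open>truncated_cdf_value\<close> has a unique solution.\<close>

definition truncated_cdf :: "(nat \<Rightarrow> real) \<Rightarrow> nat \<Rightarrow> nat \<Rightarrow> real" where
  "truncated_cdf p N j = (if j = 0 then 0 else (THE x. truncated_cdf_value p N j x))"

definition truncated_matrix :: "(nat \<Rightarrow> real) \<Rightarrow> nat \<Rightarrow> nat \<Rightarrow> nat \<Rightarrow> real" where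
  "truncated_matrix p N = power_matrix (truncated_cdf p N)"

lemma lamperti_matrix_eq:
  assumes "1 \<le> i" "1 \<le> j"
  shows "lamperti_matrix \<nu> i j = power_matrix (\<lambda>m. measure_pmf.prob \<nu> {..m}) i j"
proof -
  define M where "M = lamperti_space \<nu>"
  interpret product_prob_space "\<lambda>_::nat \<times> nat. measure_pmf \<nu>" UNIV
    by standard
  interpret PM: prob_space M
    unfolding M_def lamperti_space_def by (rule prob_space_PiM) (rule measure_pmf.prob_space_axioms)
  define A where "A m = {\<omega> \<in> space M. lamperti_chain \<omega> i 1 \<le> m}" for m
  have A_eq: "A m = {\<omega> \<in> space (PiM UNIV (\<lambda>_. measure_pmf \<nu>)). \<forall>x\<in>{1..i} \<times> {1}. \<omega> x \<in> {..m}}" for m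
    using assms(1) by (auto simp: A_def M_def lamperti_space_def)
  have sets_A: "A m \<in> sets M" for m
  proof -
    have "{\<omega> \<in> space M. \<omega> x \<in> {..m}} \<in> sets M" for x
    proof -
      have "(\<lambda>\<omega>. \<omega> x) \<in> measurable M (measure_pmf \<nu>)"
        unfolding M_def lamperti_space_def by (rule measurable_component_singleton) simp
      from measurable_sets[OF this, of "{..m}"] show ?thesis
        by (simp add: vimage_def Int_def conj_commute)
    qed
    then show ?thesis
      unfolding A_eq lamperti_space_def[symmetric] M_def[symmetric]
      by (intro sets.sets_Collect_finite_All') (use assms(1) in auto)
  qed
  have prob_A: "PM.prob (A m) = measure_pmf.prob \<nu> {..m} ^ i" for m
  proof -
    have "emeasure M (A m) = (\<Prod>x\<in>{1..i} \<times> {1::nat}. emeasure (measure_pmf \<nu>) {..m})"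
      unfolding A_eq M_def lamperti_space_def by (rule emeasure_PiM_Collect) auto
    also have "\<dots> = ennreal (measure_pmf.prob \<nu> {..m} ^ i)"
      by (simp add: measure_pmf.emeasure_eq_measure ennreal_power)
    finally show ?thesis by (simp add: measure_def)
  qed
  have "{\<omega> \<in> space M. lamperti_chain \<omega> i 1 = j} = A j - A (j - 1)"
    using assms(2) by (auto simp: A_def)
  moreover have "A (j - 1) \<subseteq> A j"
    by (auto simp: A_def)
  ultimately have "lamperti_matrix \<nu> i j = PM.prob (A j) - PM.prob (A (j - 1))"
    unfolding lamperti_matrix_def M_def[symmetric]
    by (simp add: PM.finite_measure_Diff[OF sets_A sets_A])
  then show ?thesis
    by (simp add: prob_A power_matrix_def)
qed

end

theory Submission
  imports Defs
begin

text \<open>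
  The lower row sums of a matrix \<open>F(j)\<^sup>i - F(j-1)\<^sup>i\<close> with \<open>F(0) = 0\<close> telescope to \<open>F(j)\<^sup>i\<close>, so
  failure rate monotonicity reduces to the monotonicity of \<open>F\<close>. The generating polynomial
  \<open>\<Sum>k=1..N. p k * x ^ k\<close> of nonnegative weights that do not all vanish is a strictly increasing
  bijection from \<open>[0, 1]\<close> onto \<open>[0, \<Sum>k=1..N. p k]\<close>; hence the truncated distribution functions
  exist, are unique, are nondecreasing in \<open>j\<close>, and reach \<open>1\<close> at \<open>j = N\<close>. That some weight of
  each truncation is positive follows from \<open>\<pi>(1) > 0\<close>.
\<close>

lemma sum_power_matrix:
  "(\<Sum>k=1..j. power_matrix F i k) = F j ^ i - F 0 ^ i"
  by (induction j) (auto simp: power_matrix_def)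

text \<open>The abstract \<open>S\<close> covers both \<open>{1..}\<close> and
  \<open>{1..N}\<close>: assumption \<open>S\<close> makes it an initial segment of the positive
  integers, so that lower row sums telescope from 1.\<close>

lemma failure_rate_monotone_power_matrix:
  assumes "transition_matrix S P"
    and S: "\<And>j. j \<in> S \<Longrightarrow> {k \<in> S. k \<le> j} = {1..j}"
    and P: "\<And>i j. i \<in> S \<Longrightarrow> j \<in> S \<Longrightarrow> P i j = power_matrix F i j"
    and F0: "F 0 = 0"
    and F: "\<And>j. j \<in> S \<Longrightarrow> 0 \<le> F j" "\<And>j j'. j \<in> S \<Longrightarrow> j' \<in> S \<Longrightarrow> j \<le> j' \<Longrightarrow> F j \<le> F j'"
  shows "failure_rate_monotone S P"
proof -
  have row: "row_cdf S P i j = F j ^ i" if "i \<in> S" "j \<in> S" for i j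
  proof -
    \<comment> \<open>\<open>S\<close> excludes 0. This matters because \<open>0 ^ 0 = 1\<close>:
      only for positive \<open>i\<close> does the boundary term \<open>F 0 ^ i\<close>
      vanish.\<close>
    have "i \<in> {1..i}"
      using S[OF that(1)] that(1) by blast
    then have "i \<noteq> 0"
      by simp
    have "row_cdf S P i j = (\<Sum>k\<in>{k\<in>S. k \<le> j}. power_matrix F i k)"
      unfolding row_cdf_def using P that by (intro sum.cong) auto
    also have "\<dots> = F j ^ i"
      using sum_power_matrix[of F i j] S[OF that(2)] F0 \<open>i \<noteq> 0\<close> by (simp add: power_0_left)
    finally show ?thesis .
  qed
  have "F j2 ^ i1 * F j1 ^ i2 \<le> F j1 ^ i1 * F j2 ^ i2"
    if "j1 \<in> S" "j2 \<in> S" "i1 < i2" "j1 < j2" for i1 i2 j1 j2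
  proof -
    \<comment> \<open>Both sides share the factor \<open>F j1 ^ i1 * F j2 ^ i1\<close>; what remains
      to compare is \<open>F j1 ^ d\<close> with \<open>F j2 ^ d\<close>.\<close>
    obtain d where d: "i2 = i1 + d"
      using \<open>i1 < i2\<close> less_imp_add_positive by blast
    have "F j1 ^ d \<le> F j2 ^ d"
      using that F by (intro power_mono) auto
    then have "(F j1 ^ i1 * F j2 ^ i1) * F j1 ^ d \<le> (F j1 ^ i1 * F j2 ^ i1) * F j2 ^ d"
      using that F by (intro mult_left_mono) auto
    then show ?thesis
      by (simp add: d power_add mult_ac)
  qed
  then show ?thesis
    using assms(1) by (auto simp: failure_rate_monotone_def row)
qed

lemma sum_power_strict_mono:
  fixes p :: "nat \<Rightarrow> real"
  assumes "\<And>k. k \<in> {1..N} \<Longrightarrow> 0 \<le> p k" "m \<in> {1..N}" "0 < p m" "0 \<le> x" "x < y"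
  shows "(\<Sum>k=1..N. p k * x ^ k) < (\<Sum>k=1..N. p k * y ^ k)"
proof (rule sum_strict_mono_ex1)
  show "\<forall>k\<in>{1..N}. p k * x ^ k \<le> p k * y ^ k"
    using assms by (auto intro!: mult_left_mono power_mono)
  show "\<exists>k\<in>{1..N}. p k * x ^ k < p k * y ^ k"
    \<comment> \<open>The term of index \<open>m\<close> increases strictly because its weight is
      positive and \<open>m\<close> is at least 1.\<close>
    using assms by (intro bexI[of _ m]) (auto intro!: power_strict_mono)
qed simp

lemma truncation_failure_rate_monotone:
  fixes p :: "nat \<Rightarrow> real"
  assumes p: "\<And>k. k \<in> {1..N} \<Longrightarrow> 0 \<le> p k" "m \<in> {1..N}" "0 < p m"
  shows "(\<forall>j\<in>{1..N}. \<exists>!x. truncated_cdf_value p N j x) \<and>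
    failure_rate_monotone {1..N} (truncated_matrix p N)"
proof -
  define g where "g x = (\<Sum>k=1..N. p k * x ^ k)" for x
  define F where "F = truncated_cdf p N"
  have g_less: "g x < g y" if "0 \<le> x" "x < y" for x y
    unfolding g_def by (rule sum_power_strict_mono[where m = m]) (use p that in auto)
  have g0: "g 0 = 0"
    by (simp add: g_def)
  have ex1: "\<exists>!x. truncated_cdf_value p N j x" if j: "j \<in> {1..N}" for j
  proof -
    have "0 \<le> (\<Sum>k=1..j. p k)"
      using p j by (intro sum_nonneg) auto
    \<comment> \<open>\<open>g 1\<close> is the total mass, so each partial sum lies between
      \<open>g 0\<close> and \<open>g 1\<close> and the intermediate value theorem applies.\<close>
    moreover have "(\<Sum>k=1..j. p k) \<le> g 1"
      unfolding g_def using p j by (auto intro!: sum_mono2)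
    moreover have "continuous_on {0..1} g"
      unfolding g_def by (intro continuous_intros)
    ultimately obtain x where "0 \<le> x" "x \<le> 1" "g x = (\<Sum>k=1..j. p k)"
      using IVT'[of g 0 "\<Sum>k=1..j. p k" 1] g0 by auto
    moreover have "x = y" if "0 \<le> x" "0 \<le> y" "g x = g y" for x y
      using g_less[of x y] g_less[of y x] that by fastforce
    ultimately show ?thesis
      unfolding truncated_cdf_value_def g_def by (intro ex1I[of _ x]) auto
  qed
  have F0: "F 0 = 0"
    by (simp add: F_def truncated_cdf_def)
  have val: "truncated_cdf_value p N j (F j)" if "j \<in> {1..N}" for j
    using theI'[OF ex1[OF that]] that by (simp add: F_def truncated_cdf_def)
  then have F_nonneg: "0 \<le> F j" if "j \<le> N" for j
    using that F0 by (cases "j = 0") (auto simp: truncated_cdf_value_def)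
  \<comment> \<open>The equation is extended to \<open>j = 0\<close>, where both sides vanish, since
    the first matrix column involves \<open>F 0\<close>.\<close>
  have gF: "g (F j) = (\<Sum>k=1..j. p k)" if "j \<le> N" for j
    using val[of j] that F0 g0
    by (cases "j = 0") (auto simp: truncated_cdf_value_def g_def)
  have F_mono: "F i \<le> F j" if "i \<le> j" "j \<le> N" for i j
  proof (rule ccontr)
    assume "\<not> F i \<le> F j"
    then have "g (F j) < g (F i)"
      using F_nonneg that by (intro g_less) auto
    moreover have "(\<Sum>k=1..i. p k) \<le> (\<Sum>k=1..j. p k)"
      using p that by (intro sum_mono2) auto
    ultimately show False
      using gF that by simp
  qed
  \<comment> \<open>At \<open>j = N\<close> the target is the whole mass, which 1 attains;
    uniqueness then gives \<open>F N = 1\<close>, hence rows of sum 1.\<close>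
  have "truncated_cdf_value p N N 1"
    by (simp add: truncated_cdf_value_def)
  then have FN: "F N = 1"
    using val[of N] ex1[of N] p(2) by auto
  have "transition_matrix {1..N} (power_matrix F)"
    unfolding transition_matrix_def
  proof (intro ballI conjI)
    fix i j assume "i \<in> {1..N}" "j \<in> {1..N}"
    then show "0 \<le> power_matrix F i j"
      using F_mono[of "j - 1" j] F_nonneg[of "j - 1"]
      by (auto simp: power_matrix_def intro!: power_mono)
  next
    fix i assume "i \<in> {1..N}"
    then have "(\<Sum>k\<in>{1..N}. power_matrix F i k) = 1"
      unfolding sum_power_matrix by (simp add: F0 FN power_0_left)
    then show "(power_matrix F i has_sum 1) {1..N}"
      using has_sum_finite[of "{1..N}" "power_matrix F i"] by simp
  qed
  then have "failure_rate_monotone {1..N} (power_matrix F)"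
    by (rule failure_rate_monotone_power_matrix[where F = F]) (auto simp: F0 F_nonneg F_mono)
  then show ?thesis
    using ex1 by (simp add: truncated_matrix_def F_def)
qed

lemma lamperti_failure_rate_monotone:
  assumes "set_pmf \<nu> = {1..}"
  shows "failure_rate_monotone {1..} (lamperti_matrix \<nu>)"
proof -
  define F where "F m = measure_pmf.prob \<nu> {..m}" for m
  have eq: "lamperti_matrix \<nu> i j = power_matrix F i j" if "i \<in> {1..}" "j \<in> {1..}" for i j
    using lamperti_matrix_eq[of i j \<nu>] that by (simp add: F_def[abs_def])
  have F_mono: "F i \<le> F j" if "i \<le> j" for i j
    unfolding F_def using that by (intro measure_pmf.finite_measure_mono) auto
  have F_nonneg: "0 \<le> F j" for j
    by (simp add: F_def)
  have F0: "F 0 = 0"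
    using assms by (simp add: F_def measure_pmf_zero_iff)
  have nonneg: "0 \<le> power_matrix F i j" for i j
    using F_mono[of "j - 1" j] F_nonneg by (auto simp: power_matrix_def intro!: power_mono)
  have "F \<longlonglongrightarrow> measure_pmf.prob \<nu> (\<Union>m. {..m})"
    unfolding F_def[abs_def]
    by (intro measure_pmf.finite_Lim_measure_incseq) (auto simp: incseq_def)
  moreover have "(\<Union>m. {..m}) = (UNIV :: nat set)"
    by auto
  ultimately have F_lim: "F \<longlonglongrightarrow> 1"
    by simp
  have has_sum: "(power_matrix F i has_sum 1) {1..}" if "i \<ge> 1" for i
  proof -
    \<comment> \<open>The row total telescopes to the limit of \<open>F n ^ i\<close> minus
      \<open>F 0 ^ i\<close>; the shift by \<open>Suc\<close> moves the series to the states from 1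
      on.\<close>
    have "(\<lambda>n. F n ^ i) \<longlonglongrightarrow> 1"
      using tendsto_power[OF F_lim, of i] by simp
    then have "(\<lambda>n. F (Suc n) ^ i - F n ^ i) sums (1 - F 0 ^ i)"
      by (rule telescope_sums)
    then have "(\<lambda>n. power_matrix F i (Suc n)) sums 1"
      using that by (simp add: power_matrix_def F0 power_0_left)
    then have "((\<lambda>n. power_matrix F i (Suc n)) has_sum 1) UNIV"
      by (rule sums_nonneg_imp_has_sum) (rule nonneg)
    then have "(power_matrix F i has_sum 1) (range Suc)"
      by (subst has_sum_reindex) (auto simp: o_def)
    moreover have "range Suc = {1..}"
      using greaterThan_0 by (simp add: atLeast_Suc_greaterThan)
    ultimately show ?thesis
      by simp
  qed
  have "transition_matrix {1..} (lamperti_matrix \<nu>)"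
    unfolding transition_matrix_def
  proof (intro ballI conjI)
    fix i j :: nat assume "i \<in> {1..}" "j \<in> {1..}"
    then show "0 \<le> lamperti_matrix \<nu> i j"
      by (simp add: eq nonneg)
  next
    fix i :: nat assume i: "i \<in> {1..}"
    have "(lamperti_matrix \<nu> i has_sum 1) {1..} \<longleftrightarrow> (power_matrix F i has_sum 1) {1..}"
      using eq[OF i] by (rule has_sum_cong)
    then show "(lamperti_matrix \<nu> i has_sum 1) {1..}"
      using has_sum i by simp
  qed
  then show ?thesis
    by (rule failure_rate_monotone_power_matrix[where F = F])
      (use eq F0 F_nonneg F_mono in auto)
qed

text \<open>The distribution function of \<open>\<nu>\<close> jumps by \<open>pmf \<nu> j\<close> at
  \<open>j\<close>, and positive powers preserve the strict inequality.\<close>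

lemma lamperti_matrix_pos:
  assumes "1 \<le> i" "1 \<le> j" "j \<in> set_pmf \<nu>"
  shows "0 < lamperti_matrix \<nu> i j"
proof -
  have "{..j} = insert j {..j - 1}" "j \<notin> {..j - 1}"
    using assms by auto
  then have "measure_pmf.prob \<nu> {..j} = pmf \<nu> j + measure_pmf.prob \<nu> {..j - 1}"
    by (simp add: measure_measure_pmf_finite)
  moreover have "0 < pmf \<nu> j"
    using assms(3) by (rule pmf_positive)
  ultimately have "measure_pmf.prob \<nu> {..j - 1} ^ i < measure_pmf.prob \<nu> {..j} ^ i"
    using assms(1) by (intro power_strict_mono) auto
  then show ?thesis
    using assms by (simp add: lamperti_matrix_eq power_matrix_def)
qed

text \<open>Total mass 1 forces some state \<open>i\<close> to be charged, and the single term
  \<open>\<pi> i * P i j\<close> of the balance equation already bounds \<open>\<pi> j\<close> from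
  below.\<close>

lemma invariant_probability_pos:
  assumes inv: "invariant_probability S P \<pi>" and j: "j \<in> S"
    and P: "\<And>i. i \<in> S \<Longrightarrow> 0 < P i j"
  shows "0 < \<pi> j"
proof -
  have nonneg: "\<And>k. k \<in> S \<Longrightarrow> 0 \<le> \<pi> k" and one: "(\<pi> has_sum 1) S"
    and bal: "((\<lambda>i. \<pi> i * P i j) has_sum \<pi> j) S"
    using inv j by (auto simp: invariant_probability_def)
  have "\<exists>i\<in>S. \<pi> i \<noteq> 0"
    using one has_sum_0[of S \<pi>] has_sum_unique by fastforce
  then obtain i where i: "i \<in> S" "0 < \<pi> i"
    using nonneg by force
  have "0 < \<pi> i * P i j"
    using i P by simp
  also have "\<dots> \<le> \<pi> j"
  proof (rule has_sum_mono2)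
    show "((\<lambda>i. \<pi> i * P i j) has_sum \<pi> i * P i j) {i}"
      using has_sum_finite[of "{i}" "\<lambda>i. \<pi> i * P i j"] by simp
    show "((\<lambda>i. \<pi> i * P i j) has_sum \<pi> j) S"
      by (fact bal)
  qed (use i nonneg P in \<open>auto intro!: mult_nonneg_nonneg less_imp_le[OF P]\<close>)
  finally show ?thesis .
qed

theorem corollary10:
  fixes \<nu> :: "nat pmf" and \<pi> :: "nat \<Rightarrow> real" and N :: nat
  assumes "set_pmf \<nu> = {1..}"
    and "lamperti_positive_recurrent \<nu>"
    and "invariant_probability {1..} (lamperti_matrix \<nu>) \<pi>"
    and "N \<ge> 2"
  shows "failure_rate_monotone {1..} (lamperti_matrix \<nu>) \<and>
    (\<forall>p \<in> {normalized_truncation \<pi> N, lumped_truncation \<pi> N}.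
       (\<forall>j\<in>{1..N}. \<exists>!x. truncated_cdf_value p N j x) \<and>
       failure_rate_monotone {1..N} (truncated_matrix p N))"
proof -
  have pos: "0 < \<pi> 1"
    using assms(1) by (intro invariant_probability_pos[OF assms(3)] lamperti_matrix_pos) auto
  have nonneg: "0 \<le> \<pi> k" if "k \<ge> 1" for k
    using assms(3) that by (simp add: invariant_probability_def)
  have sum_pos: "0 < (\<Sum>l=1..N. \<pi> l)"
    using pos nonneg assms(4) by (intro sum_pos2[where i = 1]) auto
  have "(\<forall>j\<in>{1..N}. \<exists>!x. truncated_cdf_value (normalized_truncation \<pi> N) N j x) \<and>
       failure_rate_monotone {1..N} (truncated_matrix (normalized_truncation \<pi> N) N)"
    using pos nonneg sum_pos assms(4)
    by (intro truncation_failure_rate_monotone[where m = 1])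
      (auto simp: normalized_truncation_def)
  \<comment> \<open>Since \<open>N \<ge> 2\<close>, state 1 lies below the lumped state and keeps
    its positive weight.\<close>
  moreover have "(\<forall>j\<in>{1..N}. \<exists>!x. truncated_cdf_value (lumped_truncation \<pi> N) N j x) \<and>
       failure_rate_monotone {1..N} (truncated_matrix (lumped_truncation \<pi> N) N)"
    using pos nonneg assms(4)
    by (intro truncation_failure_rate_monotone[where m = 1])
      (auto simp: lumped_truncation_def intro!: infsum_nonneg)
  ultimately show ?thesis
    using lamperti_failure_rate_monotone[OF assms(1)] by simp
qed

end
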